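(* Let $(G,\tau)$ be a reflexive abelian topological group. If the dual group $(G,\tau)^\wedge$ has the $qc$-Glicksberg property (in particular, if it has the Glicksberg property), then $(G,\tau)$ is a Mackey group.
   Context: Let $\mathbb{S}$ be the unit circle group and $\mathbb{S}_+=\{z\in\mathbb{S}:\ \mathrm{Re}(z)\ge 0\}$. For an abelian topological group $G$, $\widehat{G}$ is the group of all continuous characters, i.e. continuous homomorphisms $G\to\mathbb{S}$, and $G^\wedge$ is $\widehat{G}$ endowed with the compact-open topology; $G^{\wedge\wedge}=(G^\wedge)^\wedge$. The group $G$ is reflexive if the canonical homomorphism $\alpha_G:G\to G^{\wedge\wedge}$, $g\mapsto(\chi\mapsto\chi(g))$, is a topological isomorphism. $G$ is maximally almost periodic (MAP) if $\widehat{G}$ separates the points of $G$. A subset $A\subseteq G$ is quasi-convex if for every $g\in G\setminus A$ there is $\chi\in\widehat{G}$ with $\chi(g)\notin\mathbb{S}_+$ and $\chi(A)\subseteq\mathbb{S}_+$. $G$ is locally quasi-convex if it has a neighborhood base at $0$ consisting of quasi-convex sets; locally quasi-convex groups are understood to be MAP. Two group topologies $\tau,\nu$ on an abelian group $G$ are compatible if $\widehat{(G,\tau)}=\widehat{(G,\nu)}$. A locally quasi-convex abelian group $(G,\tau)$ is a Mackey group if every locally quasi-convex group topology $\nu$ on $G$ compatible with $\tau$ satisfies $\nu\le\tau$. For a MAP abelian group $H$, $\sigma(H,\widehat{H})$ is the weak topology on $H$, i.e. the smallest group topology for which all elements of $\widehat{H}$ are continuous. $H$ has the Glicksberg property if $H$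 and $(H,\sigma(H,\widehat{H}))$ have the same compact subsets. $H$ has the $qc$-Glicksberg property if the family of quasi-convex compact subsets of $H$ equals the family of quasi-convex compact subsets of $(H,\sigma(H,\widehat{H}))$. Here these are applied to $H=G^\wedge$. *)

theory Defs
  imports "HOL-Analysis.Analysis" "HOL-Algebra.Group"
begin

text \<open>A group is a record of HOL-Algebra, written multiplicatively; its topology is an
  abstract topology \<open>T\<close> with \<open>topspace T = carrier G\<close>. No Hausdorff axiom is imposed: it follows from
  reflexivity, and from maximal almost periodicity.\<close>

definition group_topology :: "('a, 'm) monoid_scheme \<Rightarrow> 'a topology \<Rightarrow> bool" where
  "group_topology G T \<longleftrightarrow>
     topspace T = carrier G \<and>
     continuous_map (prod_topology T T) T (\<lambda>(x, y). x \<otimes>\<^bsub>G\<^esub> y) \<and>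
     continuous_map T T (\<lambda>x. inv\<^bsub>G\<^esub> x)"

definition abelian_top_group :: "('a, 'm) monoid_scheme \<Rightarrow> 'a topology \<Rightarrow> bool" where
  "abelian_top_group G T \<longleftrightarrow> comm_group G \<and> group_topology G T"

definition coarser :: "'a topology \<Rightarrow> 'a topology \<Rightarrow> bool" where
  "coarser S T \<longleftrightarrow> (\<forall>U. openin S U \<longrightarrow> openin T U)"

definition circle_group :: "complex monoid" where
  "circle_group = \<lparr>carrier = sphere 0 1, mult = (*), one = 1\<rparr>"

definition circle_topology :: "complex topology" where
  "circle_topology = top_of_set (sphere 0 1)"

definition circle_plus :: "complex set" where
  "circle_plus = {z \<in> sphere 0 1. Re z \<ge> 0}"

text \<open>Characters are functions on \<open>carrier G\<close>, hence taken \<open>undefined\<close> outside of it.\<close>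

definition characters :: "('a, 'm) monoid_scheme \<Rightarrow> 'a topology \<Rightarrow> ('a \<Rightarrow> complex) set" where
  "characters G T =
     {\<phi> \<in> hom G circle_group. continuous_map T circle_topology \<phi> \<and> \<phi> \<in> extensional (carrier G)}"

definition dual_group ::
  "('a, 'm) monoid_scheme \<Rightarrow> 'a topology \<Rightarrow> ('a \<Rightarrow> complex) monoid" where
  "dual_group G T =
     \<lparr>carrier = characters G T,
      mult = (\<lambda>\<phi> \<psi>. \<lambda>x\<in>carrier G. \<phi> x * \<psi> x),
      one = (\<lambda>x\<in>carrier G. 1)\<rparr>"

text \<open>The compact-open topology; the case \<open>K = {}\<close> makes its underlying set all of
  \<open>characters G T\<close>.\<close>

definition dual_topology ::
  "('a, 'm) monoid_scheme \<Rightarrow> 'a topology \<Rightarrow> ('a \<Rightarrow> complex) topology" where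
  "dual_topology G T = topology_generated_by
     {{\<phi> \<in> characters G T. \<phi> ` K \<subseteq> V} |K V. compactin T K \<and> openin circle_topology V}"

definition bidual_group ::
  "('a, 'm) monoid_scheme \<Rightarrow> 'a topology \<Rightarrow> (('a \<Rightarrow> complex) \<Rightarrow> complex) monoid" where
  "bidual_group G T = dual_group (dual_group G T) (dual_topology G T)"

definition bidual_topology ::
  "('a, 'm) monoid_scheme \<Rightarrow> 'a topology \<Rightarrow> (('a \<Rightarrow> complex) \<Rightarrow> complex) topology" where
  "bidual_topology G T = dual_topology (dual_group G T) (dual_topology G T)"

definition canonical_hom ::
  "('a, 'm) monoid_scheme \<Rightarrow> 'a topology \<Rightarrow> 'a \<Rightarrow> (('a \<Rightarrow> complex) \<Rightarrow> complex)" where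
  "canonical_hom G T g = (\<lambda>\<phi>\<in>characters G T. \<phi> g)"

definition reflexive_group :: "('a, 'm) monoid_scheme \<Rightarrow> 'a topology \<Rightarrow> bool" where
  "reflexive_group G T \<longleftrightarrow>
     canonical_hom G T \<in> iso G (bidual_group G T) \<and>
     homeomorphic_map T (bidual_topology G T) (canonical_hom G T)"

definition MAP_group :: "('a, 'm) monoid_scheme \<Rightarrow> 'a topology \<Rightarrow> bool" where
  "MAP_group G T \<longleftrightarrow>
     (\<forall>x\<in>carrier G. \<forall>y\<in>carrier G. x \<noteq> y \<longrightarrow> (\<exists>\<phi>\<in>characters G T. \<phi> x \<noteq> \<phi> y))"

definition quasi_convex :: "('a, 'm) monoid_scheme \<Rightarrow> 'a topology \<Rightarrow> 'a set \<Rightarrow> bool" where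
  "quasi_convex G T A \<longleftrightarrow>
     A \<subseteq> carrier G \<and>
     (\<forall>g\<in>carrier G - A. \<exists>\<phi>\<in>characters G T. \<phi> g \<notin> circle_plus \<and> \<phi> ` A \<subseteq> circle_plus)"

definition locally_quasi_convex :: "('a, 'm) monoid_scheme \<Rightarrow> 'a topology \<Rightarrow> bool" where
  "locally_quasi_convex G T \<longleftrightarrow>
     abelian_top_group G T \<and> MAP_group G T \<and>
     neighbourhood_base_at \<one>\<^bsub>G\<^esub> (quasi_convex G T) T"

definition compatible_topologies ::
  "('a, 'm) monoid_scheme \<Rightarrow> 'a topology \<Rightarrow> 'a topology \<Rightarrow> bool" where
  "compatible_topologies G S T \<longleftrightarrow> characters G S = characters G T"

definition Mackey_group :: "('a, 'm) monoid_scheme \<Rightarrow> 'a topology \<Rightarrow> bool" where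
  "Mackey_group G T \<longleftrightarrow>
     locally_quasi_convex G T \<and>
     (\<forall>S. locally_quasi_convex G S \<and> compatible_topologies G S T \<longrightarrow> coarser S T)"

definition is_weak_topology ::
  "('a, 'm) monoid_scheme \<Rightarrow> 'a topology \<Rightarrow> 'a topology \<Rightarrow> bool" where
  "is_weak_topology H T S \<longleftrightarrow>
     group_topology H S \<and> (\<forall>\<phi>\<in>characters H T. continuous_map S circle_topology \<phi>) \<and>
     (\<forall>R. group_topology H R \<and> (\<forall>\<phi>\<in>characters H T. continuous_map R circle_topology \<phi>)
        \<longrightarrow> coarser S R)"

text \<open>Well defined for abelian \<open>H\<close>, by \<open>is_weak_topology_weak_topology\<close> below.\<close>

definition weak_topology :: "('a, 'm) monoid_scheme \<Rightarrow> 'a topology \<Rightarrow> 'a topology" where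
  "weak_topology H T = (THE S. is_weak_topology H T S)"

definition Glicksberg_property :: "('a, 'm) monoid_scheme \<Rightarrow> 'a topology \<Rightarrow> bool" where
  "Glicksberg_property H T \<longleftrightarrow>
     {K. compactin T K} = {K. compactin (weak_topology H T) K}"

definition qc_Glicksberg_property :: "('a, 'm) monoid_scheme \<Rightarrow> 'a topology \<Rightarrow> bool" where
  "qc_Glicksberg_property H T \<longleftrightarrow>
     {K. quasi_convex H T K \<and> compactin T K} =
     {K. quasi_convex H (weak_topology H T) K \<and> compactin (weak_topology H T) K}"

lemma is_weak_topology_unique:
  assumes "is_weak_topology H T S" "is_weak_topology H T S'"
  shows "S = S'"
  using assms unfolding is_weak_topology_def coarser_def topology_eq by blast

definition char_topology :: "('a, 'm) monoid_scheme \<Rightarrow> 'a topology \<Rightarrow> 'a topology" where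
  "char_topology H T = topology_generated_by
     {{x \<in> carrier H. \<phi> x \<in> V} |\<phi> V. \<phi> \<in> characters H T \<and> openin circle_topology V}"

lemma topspace_circle [simp]: "topspace circle_topology = sphere 0 1"
  by (simp add: circle_topology_def)

lemma continuous_map_circle_mult:
  "continuous_map (prod_topology circle_topology circle_topology) circle_topology (\<lambda>(x, y). x * y)"
proof -
  have "prod_topology circle_topology circle_topology
          = top_of_set (sphere 0 1 \<times> sphere (0::complex) 1)"
    by (simp add: circle_topology_def flip: subtopology_Times euclidean_product_topology)
  moreover have "continuous_on (sphere 0 1 \<times> sphere (0::complex) 1) (\<lambda>(x, y). x * y)"
    by (auto simp: case_prod_unfold intro!: continuous_intros)
  ultimately show ?thesis
    by (auto simp: circle_topology_def norm_mult)
qed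

lemma continuous_map_circle_inverse:
  "continuous_map circle_topology circle_topology inverse"
  by (auto simp: circle_topology_def norm_inverse intro!: continuous_intros)

lemma trivial_character:
  assumes "comm_group H" "topspace T = carrier H"
  shows "(\<lambda>x\<in>carrier H. 1) \<in> characters H T"
proof -
  interpret comm_group H by fact
  have "continuous_map T circle_topology (\<lambda>x\<in>carrier H. 1)"
    by (rule continuous_map_eq[where f = "\<lambda>x. 1"]) (auto simp: assms(2))
  then show ?thesis
    by (auto simp: characters_def hom_def circle_group_def)
qed

lemma character_mult:
  assumes "\<phi> \<in> characters H T" "x \<in> carrier H" "y \<in> carrier H"
  shows "\<phi> (x \<otimes>\<^bsub>H\<^esub> y) = \<phi> x * \<phi> y"
  using assms by (auto simp: characters_def hom_def circle_group_def)

lemma character_norm: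
  assumes "\<phi> \<in> characters H T" "x \<in> carrier H"
  shows "norm (\<phi> x) = 1"
  using assms by (auto simp: characters_def hom_def circle_group_def)

lemma character_inv:
  assumes "comm_group H" "\<phi> \<in> characters H T" "x \<in> carrier H"
  shows "\<phi> (inv\<^bsub>H\<^esub> x) = inverse (\<phi> x)"
proof -
  interpret comm_group H by fact
  have 1: "\<phi> \<one>\<^bsub>H\<^esub> = 1"
    using character_mult[OF assms(2) one_closed one_closed] character_norm[OF assms(2) one_closed]
    by auto
  have "\<phi> (inv\<^bsub>H\<^esub> x) * \<phi> x = 1"
    using character_mult[OF assms(2) inv_closed[OF assms(3)] assms(3)] 1 assms(3) by simp
  then show ?thesis
    by (metis inverse_unique mult.commute)
qed

lemma is_weak_topology_char_topology:
  assumes H: "comm_group H" and T: "topspace T = carrier H"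
  shows "is_weak_topology H T (char_topology H T)"
proof -
  interpret comm_group H by fact
  let ?S = "char_topology H T"
  let ?B = "{{x \<in> carrier H. \<phi> x \<in> V} |\<phi> V. \<phi> \<in> characters H T \<and> openin circle_topology V}"
  have top: "topspace ?S = carrier H"
  proof -
    have "openin circle_topology (sphere 0 1)"
      using openin_topspace[of circle_topology] by simp
    then have "{x \<in> carrier H. (\<lambda>x\<in>carrier H. 1) x \<in> sphere (0::complex) 1} \<in> ?B"
      using trivial_character[OF H T] by blast
    moreover have "{x \<in> carrier H. (\<lambda>x\<in>carrier H. 1) x \<in> sphere (0::complex) 1} = carrier H"
      by auto
    ultimately have "carrier H \<in> ?B"
      by simp
    moreover have "\<Union>?B \<subseteq> carrier H"
      by blast
    ultimately have "\<Union>?B = carrier H"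
      by (intro subset_antisym Union_upper)
    then show ?thesis
      by (simp only: char_topology_def topology_generated_by_topspace)
  qed
  have cont: "continuous_map ?S circle_topology \<phi>" if "\<phi> \<in> characters H T" for \<phi>
    unfolding continuous_map_def
  proof (intro conjI allI impI)
    show "\<phi> \<in> topspace ?S \<rightarrow> topspace circle_topology"
      using character_norm[OF that] by (auto simp: top)
  next
    fix V assume "openin circle_topology V"
    then show "openin ?S {x \<in> topspace ?S. \<phi> x \<in> V}"
      unfolding top unfolding char_topology_def
      by (intro topology_generated_by_Basis) (use that in blast)
  qed
  have into: "continuous_map X ?S f"
    if f: "f \<in> topspace X \<rightarrow> carrier H"
      and c: "\<And>\<phi>. \<phi> \<in> characters H T \<Longrightarrow> continuous_map X circle_topology (\<lambda>x. \<phi> (f x))"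
    for X :: "'c topology" and f
    unfolding char_topology_def
  proof (rule continuous_on_generated_topo)
    fix U assume "U \<in> {{x \<in> carrier H. \<phi> x \<in> V} |\<phi> V.
        \<phi> \<in> characters H T \<and> openin circle_topology V}"
    then obtain \<phi> V where U: "U = {x \<in> carrier H. \<phi> x \<in> V}" "\<phi> \<in> characters H T"
        "openin circle_topology V"
      by blast
    have "f -` U \<inter> topspace X = {x \<in> topspace X. \<phi> (f x) \<in> V}"
      using f U(1) by auto
    then show "openin X (f -` U \<inter> topspace X)"
      using c[OF U(2)] U(3) by (simp add: continuous_map_def)
  next
    show "f ` topspace X \<subseteq> \<Union> {{x \<in> carrier H. \<phi> x \<in> V} |\<phi> V.
        \<phi> \<in> characters H T \<and> openin circle_topology V}"
      using f top unfolding char_topology_def topology_generated_by_topspace by blast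
  qed
  have mult: "continuous_map (prod_topology ?S ?S) ?S (\<lambda>(x, y). x \<otimes>\<^bsub>H\<^esub> y)"
  proof (rule into)
    show "(\<lambda>(x, y). x \<otimes>\<^bsub>H\<^esub> y) \<in> topspace (prod_topology ?S ?S) \<rightarrow> carrier H"
      by (auto simp: top)
  next
    fix \<phi> assume \<phi>: "\<phi> \<in> characters H T"
    have "continuous_map (prod_topology ?S ?S) (prod_topology circle_topology circle_topology)
        (\<lambda>p. (\<phi> (fst p), \<phi> (snd p)))"
      by (intro continuous_map_pairedI continuous_map_compose[OF continuous_map_fst cont[OF \<phi>], unfolded o_def]
          continuous_map_compose[OF continuous_map_snd cont[OF \<phi>], unfolded o_def])
    from continuous_map_compose[OF this continuous_map_circle_mult]
    show "continuous_map (prod_topology ?S ?S) circle_topology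
        (\<lambda>p. \<phi> (case p of (x, y) \<Rightarrow> x \<otimes>\<^bsub>H\<^esub> y))"
      by (rule continuous_map_eq) (auto simp: top character_mult[OF \<phi>])
  qed
  have inv: "continuous_map ?S ?S (\<lambda>x. inv\<^bsub>H\<^esub> x)"
  proof (rule into)
    show "(\<lambda>x. inv\<^bsub>H\<^esub> x) \<in> topspace ?S \<rightarrow> carrier H"
      by (auto simp: top)
  next
    fix \<phi> assume \<phi>: "\<phi> \<in> characters H T"
    from continuous_map_compose[OF cont[OF \<phi>] continuous_map_circle_inverse]
    show "continuous_map ?S circle_topology (\<lambda>x. \<phi> (inv\<^bsub>H\<^esub> x))"
      by (rule continuous_map_eq) (auto simp: top character_inv[OF H \<phi>])
  qed
  have "coarser ?S R" if R: "group_topology H R"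
    and Rc: "\<forall>\<phi>\<in>characters H T. continuous_map R circle_topology \<phi>" for R
  proof -
    have "topspace R = carrier H"
      using R by (simp add: group_topology_def)
    then have c: "continuous_map R ?S id"
      using Rc by (intro into) auto
    show ?thesis
      unfolding coarser_def
    proof (intro allI impI)
      fix U assume U: "openin ?S U"
      have "{x \<in> topspace R. id x \<in> U} = U"
        using openin_subset[OF U] by (auto simp: top \<open>topspace R = carrier H\<close>)
      then show "openin R U"
        using openin_continuous_map_preimage[OF c U] by simp
    qed
  qed
  then show ?thesis
    unfolding is_weak_topology_def group_topology_def[of H ?S]
    using top mult inv cont by blast
qed

lemma weak_topology_eq:
  assumes "comm_group H" "topspace T = carrier H"
  shows "weak_topology H T = char_topology H T"
  unfolding weak_topology_def
  by (rule the_equality)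
    (use is_weak_topology_char_topology[OF assms] is_weak_topology_unique in blast)+

lemma is_weak_topology_weak_topology:
  assumes "comm_group H" "topspace T = carrier H"
  shows "is_weak_topology H T (weak_topology H T)"
  by (simp add: weak_topology_eq[OF assms] is_weak_topology_char_topology[OF assms])

lemma topspace_dual_topology:
  "topspace (dual_topology G T) = carrier (dual_group G T)"
proof -
  let ?B = "{{\<phi> \<in> characters G T. \<phi> ` K \<subseteq> V} |K V. compactin T K \<and> openin circle_topology V}"
  have "{\<phi> \<in> characters G T. \<phi> ` {} \<subseteq> {}} \<in> ?B"
    using compactin_empty[of T] openin_empty[of circle_topology] by blast
  then have "characters G T \<in> ?B"
    by simp
  moreover have "\<Union>?B \<subseteq> characters G T"
    by blast
  ultimately have "\<Union>?B = characters G T"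
    by (intro subset_antisym Union_upper)
  then show ?thesis
    by (simp only: dual_topology_def dual_group_def topology_generated_by_topspace partial_object.simps)
qed

lemma comm_group_dual_group:
  assumes "comm_group G" "topspace T = carrier G"
  shows "comm_group (dual_group G T)"
proof -
  interpret comm_group G by fact
  have mult: "(\<lambda>x\<in>carrier G. \<phi> x * \<psi> x) \<in> characters G T"
    if \<phi>: "\<phi> \<in> characters G T" and \<psi>: "\<psi> \<in> characters G T" for \<phi> \<psi>
  proof -
    have "continuous_map T circle_topology (\<lambda>x. \<phi> x * \<psi> x)"
      using continuous_map_compose[OF continuous_map_pairedI continuous_map_circle_mult,
          of T \<phi> \<psi>] \<phi> \<psi>
      by (simp add: characters_def o_def)
    then have "continuous_map T circle_topology (\<lambda>x\<in>carrier G. \<phi> x * \<psi> x)"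
      by (rule continuous_map_eq) (simp add: assms(2))
    then show ?thesis
      using character_norm[OF \<phi>] character_norm[OF \<psi>]
      by (auto simp: characters_def[of G T] hom_def circle_group_def norm_mult
          character_mult[OF \<phi>] character_mult[OF \<psi>])
  qed
  have inv: "(\<lambda>x\<in>carrier G. inverse (\<phi> x)) \<in> characters G T"
    if \<phi>: "\<phi> \<in> characters G T" for \<phi>
  proof -
    have "continuous_map T circle_topology (\<lambda>x. inverse (\<phi> x))"
      using continuous_map_compose[OF _ continuous_map_circle_inverse, of T \<phi>] \<phi>
      by (simp add: characters_def o_def)
    then have "continuous_map T circle_topology (\<lambda>x\<in>carrier G. inverse (\<phi> x))"
      by (rule continuous_map_eq) (simp add: assms(2))
    then show ?thesis
      using character_norm[OF \<phi>]
      by (auto simp: characters_def[of G T] hom_def circle_group_def norm_inverse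
          character_mult[OF \<phi>])
  qed
  have ext: "\<phi> \<in> extensional (carrier G)" if "\<phi> \<in> characters G T" for \<phi>
    using that by (simp add: characters_def)
  show ?thesis
  proof (rule comm_groupI)
    fix \<phi> assume "\<phi> \<in> carrier (dual_group G T)"
    then have \<phi>: "\<phi> \<in> characters G T"
      by (simp add: dual_group_def)
    have nz: "\<phi> x \<noteq> 0" if "x \<in> carrier G" for x
      using character_norm[OF \<phi> that] by auto
    show "\<one>\<^bsub>dual_group G T\<^esub> \<otimes>\<^bsub>dual_group G T\<^esub> \<phi> = \<phi>"
      using ext[OF \<phi>] by (auto simp: dual_group_def intro: extensionalityI)
    show "\<exists>\<psi>\<in>carrier (dual_group G T). \<psi> \<otimes>\<^bsub>dual_group G T\<^esub> \<phi> = \<one>\<^bsub>dual_group G T\<^esub>"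
      by (rule bexI[of _ "\<lambda>x\<in>carrier G. inverse (\<phi> x)"])
        (use inv[OF \<phi>] nz in \<open>auto simp: dual_group_def fun_eq_iff\<close>)
  qed (use mult trivial_character[OF assms] in \<open>auto simp: dual_group_def fun_eq_iff mult_ac\<close>)
qed

lemma is_weak_topology_dual:
  assumes "abelian_top_group G T"
  shows "is_weak_topology (dual_group G T) (dual_topology G T)
           (weak_topology (dual_group G T) (dual_topology G T))"
  using assms
  by (intro is_weak_topology_weak_topology comm_group_dual_group topspace_dual_topology)
    (auto simp: abelian_top_group_def group_topology_def)

end

theory Submission
  imports Defs
begin

text \<open>Write \<open>H\<close> for the dual group of \<open>G\<close> with its compact-open topology, and call
  \<open>polar G T U\<close> the set of characters that map \<open>U\<close> into the right half \<open>circle_plus\<close> of the circle.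

  Reflexivity is used through two facts. The characters of \<open>H\<close> are exactly the evaluations at points
  of \<open>G\<close>, so the weak topology of \<open>H\<close> is the topology of pointwise convergence. And the topology \<open>T\<close> is
  the compact-open topology on the dual of \<open>H\<close>, so the prepolars of the compact subsets of \<open>H\<close>
  form a neighbourhood base at the identity (\<open>reflexive_prepolar_neighbourhood\<close>,
  \<open>reflexive_prepolar_base\<close>). Prepolars are quasi-convex, so \<open>T\<close> is locally quasi-convex.

  Now let \<open>S\<close> be a locally quasi-convex topology with the same characters as \<open>T\<close>, and let \<open>U\<close> be a
  quasi-convex \<open>S\<close>-neighbourhood of the identity. Its polar \<open>K\<close> is compact for pointwise convergence,
  as in the theorem of Alaoglu (\<open>compactin_polar\<close>), and is quasi-convex because it is cut out by
  evaluations (\<open>quasi_convex_polar\<close>). Hence \<open>K\<close> is a quasi-convex compact set of the weak topology of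
  \<open>H\<close>, and either Glicksberg property makes it compact in \<open>H\<close>. But quasi-convexity of \<open>U\<close> says that
  \<open>U\<close> is the prepolar of \<open>K\<close> (\<open>prepolar_polar\<close>), so \<open>U\<close> is a \<open>T\<close>-neighbourhood of the identity;
  translating, \<open>S\<close> is coarser than \<open>T\<close>.

  The passage from \<open>circle_plus\<close> to arbitrarily small neighbourhoods of \<open>1\<close>, needed twice, rests on
  repeated squaring: a point of the circle whose first iterated squares all stay in the right
  half-plane is close to \<open>1\<close> (\<open>near_one_if_squares_in_half_plane\<close>).\<close>

section \<open>Iterated squares on the circle\<close>

text \<open>On the right half of the circle \<open>\<bar>z + 1\<bar> \<ge> sqrt 2\<close>, so that squaring expands the distance to
  \<open>1\<close> by a factor of at least \<open>sqrt 2\<close>. As no point of the circle is further than \<open>2\<close> from \<open>1\<close>, this can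
  happen many times only when starting close to \<open>1\<close>.\<close>

lemma near_one_if_squares_in_half_plane:
  fixes e :: real
  assumes "e > 0"
  shows "\<exists>n::nat. \<forall>z::complex. norm z = 1 \<and> (\<forall>j<n. z ^ (2 ^ j) \<in> circle_plus) \<longrightarrow> norm (z - 1) < e"
proof -
  have expand: "sqrt 2 * norm (z - 1) \<le> norm (z\<^sup>2 - 1)" if "norm z = 1" "Re z \<ge> 0" for z :: complex
  proof -
    have "(Re z)\<^sup>2 + (Im z)\<^sup>2 = 1"
      using that(1) by (simp add: cmod_def)
    then have "(norm (z + 1))\<^sup>2 \<ge> 2"
      using that(2) by (simp only: cmod_power2) (simp add: power2_eq_square algebra_simps)
    then have "sqrt 2 \<le> norm (z + 1)"
      by (simp add: real_le_lsqrt)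
    then have "sqrt 2 * norm (z - 1) \<le> norm (z + 1) * norm (z - 1)"
      by (intro mult_right_mono) auto
    also have "\<dots> = norm (z\<^sup>2 - 1)"
      by (simp add: power2_eq_square algebra_simps flip: norm_mult)
    finally show ?thesis .
  qed
  have iterate: "sqrt 2 ^ n * norm (z - 1) \<le> norm (z ^ (2 ^ n) - 1)"
    if "norm z = 1" "\<forall>j<n. z ^ (2 ^ j) \<in> circle_plus" for z :: complex and n
    using that
  proof (induction n)
    case 0
    then show ?case by simp
  next
    case (Suc n)
    have "sqrt 2 ^ Suc n * norm (z - 1) \<le> sqrt 2 * norm (z ^ (2 ^ n) - 1)"
      using Suc.IH Suc.prems by simp
    also have "\<dots> \<le> norm ((z ^ (2 ^ n))\<^sup>2 - 1)"
      using Suc.prems by (intro expand) (auto simp: circle_plus_def norm_power)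
    also have "(z ^ (2 ^ n))\<^sup>2 = z ^ (2 ^ Suc n)"
      by (simp add: mult.commute flip: power_mult)
    finally show ?case .
  qed
  obtain n :: nat where n: "2 / e < sqrt 2 ^ n"
    using real_arch_pow[of "sqrt 2" "2 / e"] by auto
  have "norm (z - 1) < e" if "norm z = 1" "\<forall>j<n. z ^ (2 ^ j) \<in> circle_plus" for z :: complex
  proof -
    have "sqrt 2 ^ n * norm (z - 1) \<le> norm (z ^ (2 ^ n) - 1)"
      using iterate[OF that] .
    also have "\<dots> \<le> 2"
      using norm_triangle_ineq4[of "z ^ (2 ^ n)" 1] that(1) by (simp add: norm_power)
    also have "\<dots> < sqrt 2 ^ n * e"
      using n \<open>e > 0\<close> by (simp add: field_simps)
    finally show ?thesis
      by simp
  qed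
  then show ?thesis
    by blast
qed

lemma iterated_square_closed:
  assumes "comm_group X" "x \<in> carrier X"
  shows "((\<lambda>x. x \<otimes>\<^bsub>X\<^esub> x) ^^ j) x \<in> carrier X"
proof -
  interpret comm_group X by fact
  show ?thesis
    by (induction j) (use assms(2) in auto)
qed

lemma hom_circle_iterated_square:
  assumes "comm_group X" "f \<in> hom X circle_group" "x \<in> carrier X"
  shows "f (((\<lambda>x. x \<otimes>\<^bsub>X\<^esub> x) ^^ j) x) = f x ^ (2 ^ j)"
proof (induction j)
  case 0
  then show ?case by simp
next
  case (Suc j)
  show ?case
    using hom_mult[OF assms(2) iterated_square_closed iterated_square_closed] assms(1,3) Suc.IH
    by (simp add: circle_group_def mult_2 flip: power_add)
qed

lemma continuous_map_iterate:
  assumes "continuous_map X X f"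
  shows "continuous_map X X (f ^^ j)"
proof (induction j)
  case 0
  then show ?case by (simp add: id_def)
next
  case (Suc j)
  then show ?case
    unfolding funpow.simps(2) by (rule continuous_map_compose[OF _ assms])
qed

section \<open>Topological groups and their characters\<close>

lemma continuous_map_square:
  assumes "group_topology G S"
  shows "continuous_map S S (\<lambda>x. x \<otimes>\<^bsub>G\<^esub> x)"
proof -
  have "continuous_map S (prod_topology S S) (\<lambda>x. (x, x))"
    by (intro continuous_map_pairedI) auto
  from continuous_map_compose[OF this, of S "\<lambda>(x, y). x \<otimes>\<^bsub>G\<^esub> y"] show ?thesis
    using assms by (simp add: group_topology_def o_def)
qed

lemma continuous_map_translation:
  assumes "group_topology G S" "a \<in> carrier G"
  shows "continuous_map S S (\<lambda>x. a \<otimes>\<^bsub>G\<^esub> x)"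
proof -
  have "continuous_map S (prod_topology S S) (\<lambda>x. (a, x))"
    using assms by (intro continuous_map_pairedI) (auto simp: group_topology_def)
  from continuous_map_compose[OF this, of S "\<lambda>(x, y). x \<otimes>\<^bsub>G\<^esub> y"] show ?thesis
    using assms by (simp add: group_topology_def o_def)
qed

lemma openin_translation_preimage:
  assumes "group_topology G S" "a \<in> carrier G" "openin S W"
  shows "openin S {y \<in> carrier G. a \<otimes>\<^bsub>G\<^esub> y \<in> W}"
  using openin_continuous_map_preimage[OF continuous_map_translation[OF assms(1,2)] assms(3)]
    assms(1) by (simp add: group_topology_def)

lemma hom_circle_one:
  assumes "comm_group G" "f \<in> hom G circle_group"
  shows "f \<one>\<^bsub>G\<^esub> = 1"
proof -
  interpret comm_group G by fact
  have "f \<one>\<^bsub>G\<^esub> = f \<one>\<^bsub>G\<^esub> * f \<one>\<^bsub>G\<^esub>" "norm (f \<one>\<^bsub>G\<^esub>) = 1"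
    using hom_mult[OF assms(2), of "\<one>\<^bsub>G\<^esub>" "\<one>\<^bsub>G\<^esub>"] hom_in_carrier[OF assms(2), of "\<one>\<^bsub>G\<^esub>"]
    by (simp_all add: circle_group_def)
  then show ?thesis
    by auto
qed

lemma character_hom: "\<phi> \<in> characters G T \<Longrightarrow> \<phi> \<in> hom G circle_group"
  by (simp add: characters_def)

text \<open>Near the identity even the iterated squares of a point stay in \<open>N\<close>, which forces the values
  of the homomorphism to be close to \<open>1\<close>; translation carries this to every other point. So a
  homomorphism bounded in this sense is continuous, which is why polars of neighbourhoods are closed
  in the space of all functions.\<close>

lemma continuous_hom_if_half_plane_near_one:
  fixes G (structure)
  assumes G: "comm_group G" and S: "group_topology G S" and f: "f \<in> hom G circle_group"
    and N: "openin S N" "\<one>\<^bsub>G\<^esub> \<in> N" "f ` N \<subseteq> circle_plus"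
  shows "continuous_map S circle_topology f"
proof -
  interpret comm_group G by fact
  let ?sq = "\<lambda>x. x \<otimes>\<^bsub>G\<^esub> x"
  have top: "topspace S = carrier G"
    using S by (simp add: group_topology_def)
  have norm_f: "norm (f x) = 1" if "x \<in> carrier G" for x
    using hom_in_carrier[OF f that] by (simp add: circle_group_def)
  have nbhd: "\<exists>A. openin S A \<and> x \<in> A \<and> (\<forall>y\<in>A. norm (f y - f x) < e)"
    if x: "x \<in> carrier G" and e: "e > 0" for x and e :: real
  proof -
    obtain n :: nat where n: "\<And>z::complex. norm z = 1 \<Longrightarrow> \<forall>j<n. z ^ (2 ^ j) \<in> circle_plus
        \<Longrightarrow> norm (z - 1) < e"
      using near_one_if_squares_in_half_plane[OF e] by blast
    \<comment> \<open>the points whose first iterated squares all lie in \<open>N\<close>; its translate to \<open>x\<close> is the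
      neighbourhood sought\<close>
    define M where "M = (\<Inter>j\<in>{..n}. {y \<in> carrier G. (?sq ^^ j) y \<in> N})"
    have "openin S {y \<in> carrier G. (?sq ^^ j) y \<in> N}" for j
      using openin_continuous_map_preimage[OF continuous_map_iterate[OF continuous_map_square[OF S]]
          N(1), of j]
      by (simp only: top)
    then have "openin S M"
      unfolding M_def by (intro openin_INT2) auto
    then have A: "openin S {y \<in> carrier G. inv x \<otimes> y \<in> M}"
      using openin_translation_preimage[OF S] x by simp
    have "(?sq ^^ j) \<one> = \<one>" for j
      by (induction j) auto
    then have "\<one> \<in> M"
      by (auto simp: M_def N(2))
    have close: "norm (f y - f x) < e" if y: "y \<in> carrier G" "inv x \<otimes> y \<in> M" for y
    proof -
      let ?d = "inv x \<otimes> y"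
      have d: "?d \<in> carrier G"
        using x y by simp
      have "f ?d ^ (2 ^ j) \<in> circle_plus" if "j < n" for j
      proof -
        have "(?sq ^^ j) ?d \<in> N"
          using y(2) that by (auto simp: M_def)
        then show ?thesis
          using N(3) hom_circle_iterated_square[OF G f d, of j] by auto
      qed
      then have "norm (f ?d - 1) < e"
        using n norm_f[OF d] by blast
      have "x \<otimes> ?d = y"
        using x y by (simp add: m_assoc[symmetric])
      then have "f y = f x * f ?d"
        using hom_mult[OF f x d] by (simp add: circle_group_def)
      then have "f y - f x = f x * (f ?d - 1)"
        by (simp add: algebra_simps)
      then show ?thesis
        using norm_f[OF x] \<open>norm (f ?d - 1) < e\<close> by (simp add: norm_mult)
    qed
    show ?thesis
      by (rule exI[of _ "{y \<in> carrier G. inv x \<otimes> y \<in> M}"]) (use A x \<open>\<one> \<in> M\<close> close in auto)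
  qed
  show ?thesis
    unfolding continuous_map_def
  proof (intro conjI allI impI)
    show "f \<in> topspace S \<rightarrow> topspace circle_topology"
      using norm_f by (auto simp: top)
  next
    fix V assume V: "openin circle_topology V"
    show "openin S {x \<in> topspace S. f x \<in> V}"
    proof (subst openin_subopen, intro ballI)
      fix x assume "x \<in> {x \<in> topspace S. f x \<in> V}"
      then have x: "x \<in> carrier G" "f x \<in> V"
        by (auto simp: top)
      obtain e where e: "e > 0" "ball (f x) e \<inter> sphere 0 1 \<subseteq> V"
        using V x(2) unfolding circle_topology_def openin_contains_ball by blast
      obtain A where A: "openin S A" "x \<in> A" "\<forall>y\<in>A. norm (f y - f x) < e"
        using nbhd[OF x(1) e(1)] by blast
      have "A \<subseteq> {x \<in> topspace S. f x \<in> V}"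
      proof
        fix y assume "y \<in> A"
        then have "y \<in> carrier G"
          using openin_subset[OF A(1)] top by auto
        moreover have "f y \<in> ball (f x) e \<inter> sphere 0 1"
          using A(3) \<open>y \<in> A\<close> norm_f[OF \<open>y \<in> carrier G\<close>] by (auto simp: dist_norm norm_minus_commute)
        ultimately show "y \<in> {x \<in> topspace S. f x \<in> V}"
          using e(2) by (auto simp: top)
      qed
      then show "\<exists>A. openin S A \<and> x \<in> A \<and> A \<subseteq> {x \<in> topspace S. f x \<in> V}"
        using A by blast
    qed
  qed
qed

text \<open>Coarseness can be tested at the identity, because translations are homeomorphisms.\<close>

lemma coarser_if_neighbourhoods_of_one:
  fixes G (structure)
  assumes G: "comm_group G" and S: "group_topology G S" and T: "group_topology G T"
    and nbhd: "\<And>W. openin S W \<Longrightarrow> \<one>\<^bsub>G\<^esub> \<in> W \<Longrightarrow> \<exists>A. openin T A \<and> \<one>\<^bsub>G\<^esub> \<in> A \<and> A \<subseteq> W"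
  shows "coarser S T"
  unfolding coarser_def
proof (intro allI impI)
  interpret comm_group G by fact
  fix W assume W: "openin S W"
  show "openin T W"
  proof (subst openin_subopen, intro ballI)
    fix x assume x: "x \<in> W"
    then have xG: "x \<in> carrier G"
      using openin_subset[OF W] S by (auto simp: group_topology_def)
    have "openin S {y \<in> carrier G. x \<otimes> y \<in> W}"
      using openin_translation_preimage[OF S xG W] .
    moreover have "\<one> \<in> {y \<in> carrier G. x \<otimes> y \<in> W}"
      using x xG by simp
    ultimately obtain A where A: "openin T A" "\<one> \<in> A" "A \<subseteq> {y \<in> carrier G. x \<otimes> y \<in> W}"
      using nbhd by blast
    have "openin T {y \<in> carrier G. inv x \<otimes> y \<in> A}"
      using openin_translation_preimage[OF T _ A(1)] xG by simp
    moreover have "x \<in> {y \<in> carrier G. inv x \<otimes> y \<in> A}"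
      using xG A(2) by simp
    moreover have "{y \<in> carrier G. inv x \<otimes> y \<in> A} \<subseteq> W"
    proof
      fix y assume "y \<in> {y \<in> carrier G. inv x \<otimes> y \<in> A}"
      then have "y \<in> carrier G" "x \<otimes> (inv x \<otimes> y) \<in> W"
        using A(3) by auto
      then show "y \<in> W"
        using xG by (simp add: m_assoc[symmetric])
    qed
    ultimately show "\<exists>B. openin T B \<and> x \<in> B \<and> B \<subseteq> W"
      by blast
  qed
qed

section \<open>Polars\<close>

definition polar :: "('a, 'm) monoid_scheme \<Rightarrow> 'a topology \<Rightarrow> 'a set \<Rightarrow> ('a \<Rightarrow> complex) set" where
  "polar G T A = {\<phi> \<in> characters G T. \<phi> ` A \<subseteq> circle_plus}"

definition prepolar :: "('a, 'm) monoid_scheme \<Rightarrow> ('a \<Rightarrow> complex) set \<Rightarrow> 'a set" where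
  "prepolar G K = {g \<in> carrier G. \<forall>\<phi>\<in>K. \<phi> g \<in> circle_plus}"

text \<open>The characters that separate points from \<open>U\<close> in the definition of quasi-convexity are those of
  the polar.\<close>

lemma prepolar_polar:
  assumes "quasi_convex G T U"
  shows "prepolar G (polar G T U) = U"
  using assms unfolding quasi_convex_def prepolar_def polar_def by blast

lemma quasi_convex_prepolar:
  assumes "K \<subseteq> characters G T"
  shows "quasi_convex G T (prepolar G K)"
  using assms unfolding quasi_convex_def prepolar_def by blast

text \<open>A version of the theorem of Alaoglu. By Tychonoff the space of all circle-valued functions on
  \<open>G\<close> is compact, and the polar is closed in it: both the homomorphism equations and the half-plane
  conditions are closed, and they imply continuity.\<close>

lemma compactin_polar:
  fixes G (structure)
  assumes G: "comm_group G" and S: "group_topology G S"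
    and N: "openin S N" "\<one>\<^bsub>G\<^esub> \<in> N" "N \<subseteq> U" and U: "U \<subseteq> carrier G"
  shows "compactin (product_topology (\<lambda>_. circle_topology) (carrier G)) (polar G S U)"
proof -
  interpret comm_group G by fact
  let ?P = "product_topology (\<lambda>_. circle_topology) (carrier G)"
  have topP: "topspace ?P = (\<Pi>\<^sub>E x\<in>carrier G. sphere 0 1)"
    by simp
  have proj: "continuous_map ?P circle_topology (\<lambda>f. f x)" if "x \<in> carrier G" for x
    using continuous_map_product_projection[OF that] by fast
  have hom_closed: "closedin ?P {f \<in> topspace ?P. f (x \<otimes> y) = f x * f y}"
    if "x \<in> carrier G" "y \<in> carrier G" for x y
  proof (rule closedin_continuous_maps_eq[where Y = circle_topology])
    show "Hausdorff_space circle_topology"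
      by (simp add: circle_topology_def Hausdorff_space_subtopology)
    show "continuous_map ?P circle_topology (\<lambda>f. f (x \<otimes> y))"
      using proj that by simp
    have "continuous_map ?P (prod_topology circle_topology circle_topology) (\<lambda>f. (f x, f y))"
      using proj that by (intro continuous_map_pairedI)
    from continuous_map_compose[OF this continuous_map_circle_mult]
    show "continuous_map ?P circle_topology (\<lambda>f. f x * f y)"
      by (simp add: o_def)
  qed
  have "closedin circle_topology circle_plus"
  proof -
    have "circle_plus = sphere 0 1 \<inter> {z. Re z \<ge> 0}"
      by (auto simp: circle_plus_def)
    then show ?thesis
      using closedin_closed_Int[OF closed_halfspace_Re_ge[of 0], of "sphere 0 1"]
      by (simp add: circle_topology_def)
  qed
  then have plus_closed: "closedin ?P {f \<in> topspace ?P. f x \<in> circle_plus}" if "x \<in> U" for x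
    using that U by (intro closedin_continuous_map_preimage[OF proj]) auto
  let ?mult = "\<lambda>x y. {f \<in> topspace ?P. f (x \<otimes> y) = f x * f y}"
  let ?plus = "\<lambda>x. {f \<in> topspace ?P. f x \<in> circle_plus}"
  let ?C = "insert (topspace ?P) ((\<Union>x\<in>carrier G. ?mult x ` carrier G) \<union> ?plus ` U)"
  have polar_iff: "f \<in> polar G S U \<longleftrightarrow> f \<in> topspace ?P \<and>
      (\<forall>x\<in>carrier G. \<forall>y\<in>carrier G. f (x \<otimes> y) = f x * f y) \<and> (\<forall>x\<in>U. f x \<in> circle_plus)" for f
  proof (intro iffI)
    assume "f \<in> polar G S U"
    then have f: "f \<in> characters G S" "f ` U \<subseteq> circle_plus"
      by (auto simp: polar_def)
    then have "f \<in> topspace ?P"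
      using character_norm[OF f(1)] by (auto simp: topP PiE_def characters_def)
    then show "f \<in> topspace ?P \<and> (\<forall>x\<in>carrier G. \<forall>y\<in>carrier G. f (x \<otimes> y) = f x * f y) \<and>
        (\<forall>x\<in>U. f x \<in> circle_plus)"
      using f(2) character_mult[OF f(1)] by blast
  next
    assume f: "f \<in> topspace ?P \<and> (\<forall>x\<in>carrier G. \<forall>y\<in>carrier G. f (x \<otimes> y) = f x * f y) \<and>
        (\<forall>x\<in>U. f x \<in> circle_plus)"
    then have fP: "f \<in> carrier G \<rightarrow> sphere 0 1" "f \<in> extensional (carrier G)"
      unfolding topP PiE_def by blast+
    have fhom: "f \<in> hom G circle_group"
      using f fP(1) by (simp add: hom_def circle_group_def)
    have fU: "f ` U \<subseteq> circle_plus"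
      using f by blast
    then have "f ` N \<subseteq> circle_plus"
      using N(3) by blast
    then have "continuous_map S circle_topology f"
      by (rule continuous_hom_if_half_plane_near_one[OF G S fhom N(1,2)])
    then show "f \<in> polar G S U"
      using fP(2) fhom fU by (simp add: polar_def characters_def)
  qed
  have "polar G S U = \<Inter>?C"
  proof (intro subset_antisym subsetI)
    fix f assume "f \<in> polar G S U"
    then have f: "f \<in> topspace ?P" "\<And>x y. x \<in> carrier G \<Longrightarrow> y \<in> carrier G \<Longrightarrow> f \<in> ?mult x y"
        "\<And>x. x \<in> U \<Longrightarrow> f \<in> ?plus x"
      unfolding polar_iff by blast+
    then show "f \<in> \<Inter>?C"
      by (intro InterI) blast
  next
    fix f assume f: "f \<in> \<Inter>?C"
    then have "f \<in> topspace ?P"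
      by blast
    moreover have "f \<in> ?mult x y" if "x \<in> carrier G" "y \<in> carrier G" for x y
      by (rule InterD[OF f]) (use that in blast)
    moreover have "f \<in> ?plus x" if "x \<in> U" for x
      by (rule InterD[OF f]) (use that in blast)
    ultimately show "f \<in> polar G S U"
      unfolding polar_iff by blast
  qed
  moreover have "closedin ?P (\<Inter>?C)"
  proof (rule closedin_Inter)
    fix A assume "A \<in> ?C"
    then show "closedin ?P A"
      using hom_closed plus_closed closedin_topspace by blast
  qed blast
  ultimately have "closedin ?P (polar G S U)"
    by simp
  moreover have "compact_space ?P"
    by (auto simp: compact_space_product_topology circle_topology_def compact_space_subtopology
        compactin_subtopology)
  ultimately show ?thesis
    by (rule closedin_compact_space[rotated])
qed

section \<open>The compact-open topology on the dual\<close>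

lemma carrier_dual_group [simp]: "carrier (dual_group G T) = characters G T"
  by (simp add: dual_group_def)

lemma openin_dual_topology_subbasic:
  assumes "compactin T K" "openin circle_topology V"
  shows "openin (dual_topology G T) {\<phi> \<in> characters G T. \<phi> ` K \<subseteq> V}"
  unfolding dual_topology_def
  by (intro topology_generated_by_Basis) (use assms in blast)

text \<open>Squaring a character pulls the condition that \<open>K\<close> is mapped into \<open>V\<close> back to the same
  condition for the preimage of \<open>V\<close> under squaring.\<close>

lemma continuous_map_dual_square:
  assumes G: "comm_group G" and T: "topspace T = carrier G"
  shows "continuous_map (dual_topology G T) (dual_topology G T) (\<lambda>\<phi>. \<phi> \<otimes>\<^bsub>dual_group G T\<^esub> \<phi>)"
proof -
  interpret H: comm_group "dual_group G T"
    using comm_group_dual_group[OF G T] .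
  let ?sq = "\<lambda>\<phi>. \<phi> \<otimes>\<^bsub>dual_group G T\<^esub> \<phi>"
  have top: "topspace (dual_topology G T) = characters G T"
    by (simp add: topspace_dual_topology)
  have closed: "?sq \<phi> \<in> characters G T" if "\<phi> \<in> characters G T" for \<phi>
    using H.m_closed[of \<phi> \<phi>] that by simp
  show ?thesis
  proof (subst (2) dual_topology_def, rule continuous_on_generated_topo)
    fix W assume "W \<in> {{\<phi> \<in> characters G T. \<phi> ` K \<subseteq> V} |K V.
        compactin T K \<and> openin circle_topology V}"
    then obtain K V where W: "W = {\<phi> \<in> characters G T. \<phi> ` K \<subseteq> V}" and K: "compactin T K"
        and V: "openin circle_topology V"
      by blast
    let ?V = "{z \<in> topspace circle_topology. z * z \<in> V}"
    have sub: "K \<subseteq> carrier G"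
      using compactin_subset_topspace[OF K] T by simp
    have "continuous_map circle_topology (prod_topology circle_topology circle_topology) (\<lambda>z. (z, z))"
      by (intro continuous_map_pairedI) auto
    from continuous_map_compose[OF this continuous_map_circle_mult]
    have "continuous_map circle_topology circle_topology (\<lambda>z. z * z)"
      by (simp add: o_def)
    then have "openin circle_topology ?V"
      using V by (rule openin_continuous_map_preimage)
    then have "openin (dual_topology G T) {\<phi> \<in> characters G T. \<phi> ` K \<subseteq> ?V}"
      by (rule openin_dual_topology_subbasic[OF K])
    moreover have "?sq -` W \<inter> topspace (dual_topology G T) = {\<phi> \<in> characters G T. \<phi> ` K \<subseteq> ?V}"
    proof -
      have "?sq \<phi> \<in> W \<longleftrightarrow> \<phi> ` K \<subseteq> ?V" if \<phi>: "\<phi> \<in> characters G T" for \<phi>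
      proof -
        have "?sq \<phi> x = \<phi> x * \<phi> x" if "x \<in> K" for x
          using sub that by (auto simp: dual_group_def)
        then show ?thesis
          using closed[OF \<phi>] sub character_norm[OF \<phi>] by (auto simp: W image_subset_iff)
      qed
      then show ?thesis
        by (auto simp: top)
    qed
    ultimately show "openin (dual_topology G T) (?sq -` W \<inter> topspace (dual_topology G T))"
      by simp
  next
    show "?sq ` topspace (dual_topology G T) \<subseteq> \<Union> {{\<phi> \<in> characters G T. \<phi> ` K \<subseteq> V} |K V.
        compactin T K \<and> openin circle_topology V}"
      using closed top unfolding dual_topology_def topology_generated_by_topspace by blast
  qed
qed

text \<open>For a subbasic set given by \<open>C\<close> and a neighbourhood \<open>V\<close> of \<open>1\<close>, the polar of finitely many
  iterated squares of \<open>C\<close> suffices, since on it all values on \<open>C\<close> are close to \<open>1\<close>. The union of the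
  compact sets serves for finite intersections.\<close>

lemma polar_base_dual_topology:
  assumes G: "comm_group G" and T: "topspace T = carrier G"
    and sq: "continuous_map T T (\<lambda>x. x \<otimes>\<^bsub>G\<^esub> x)"
    and W: "openin (dual_topology G T) W" "\<one>\<^bsub>dual_group G T\<^esub> \<in> W"
  shows "\<exists>K. compactin T K \<and> polar G T K \<subseteq> W"
proof -
  let ?sq = "\<lambda>x. x \<otimes>\<^bsub>G\<^esub> x"
  have "generate_topology_on {{\<phi> \<in> characters G T. \<phi> ` K \<subseteq> V} |K V.
      compactin T K \<and> openin circle_topology V} W"
    using W(1) by (simp add: dual_topology_def openin_topology_generated_by_iff)
  from this W(2) show ?thesis
  proof (induction rule: generate_topology_on.induct)
    case Empty
    then show ?case by simp
  next
    case (Int A B)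
    then obtain K L where "compactin T K" "polar G T K \<subseteq> A" "compactin T L" "polar G T L \<subseteq> B"
      by auto
    then have "compactin T (K \<union> L)" "polar G T (K \<union> L) \<subseteq> A \<inter> B"
      by (auto simp: compactin_Un polar_def)
    then show ?case
      by blast
  next
    case (UN \<A>)
    then show ?case
      by blast
  next
    case (Basis A)
    then obtain C V where A: "A = {\<phi> \<in> characters G T. \<phi> ` C \<subseteq> V}" and C: "compactin T C"
        and V: "openin circle_topology V"
      by blast
    have sub: "C \<subseteq> carrier G"
      using compactin_subset_topspace[OF C] T by simp
    \<comment> \<open>only for nonempty \<open>C\<close> does the trivial character force \<open>1 \<in> V\<close>\<close>
    show ?case
    proof (cases "C = {}")
      case True
      then show ?thesis
        using C by (auto simp: A polar_def)
    next
      case False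
      then have "1 \<in> V"
        using Basis.prems sub by (auto simp: A dual_group_def)
      then obtain e where e: "e > 0" "ball 1 e \<inter> sphere 0 1 \<subseteq> V"
        using V unfolding circle_topology_def openin_contains_ball by blast
      obtain n :: nat where n: "\<And>z::complex. norm z = 1 \<Longrightarrow> \<forall>j<n. z ^ (2 ^ j) \<in> circle_plus
          \<Longrightarrow> norm (z - 1) < e"
        using near_one_if_squares_in_half_plane[OF e(1)] by blast
      define K where "K = (\<Union>j\<in>{..<n}. (?sq ^^ j) ` C)"
      have "compactin T K"
        unfolding K_def
        by (rule compactin_Union) (auto intro: image_compactin[OF C continuous_map_iterate[OF sq]])
      moreover have "polar G T K \<subseteq> A"
      proof
        fix \<phi> assume "\<phi> \<in> polar G T K"
        then have \<phi>: "\<phi> \<in> characters G T" and \<phi>K: "\<phi> ` K \<subseteq> circle_plus"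
          by (auto simp: polar_def)
        have "\<phi> x \<in> V" if x: "x \<in> C" for x
        proof -
          have xG: "x \<in> carrier G"
            using x sub by blast
          have "\<phi> x ^ (2 ^ j) \<in> circle_plus" if "j < n" for j
          proof -
            have "(?sq ^^ j) x \<in> K"
              using that x by (auto simp: K_def)
            then show ?thesis
              using \<phi>K hom_circle_iterated_square[OF G character_hom[OF \<phi>] xG, of j] by auto
          qed
          then have "norm (\<phi> x - 1) < e"
            using n character_norm[OF \<phi> xG] by blast
          then show ?thesis
            using e(2) character_norm[OF \<phi> xG] by (auto simp: dist_norm norm_minus_commute)
        qed
        then show "\<phi> \<in> A"
          using \<phi> by (auto simp: A)
      qed
      ultimately show ?thesis
        by blast
    qed
  qed
qed

section \<open>Reflexive groups\<close>

lemma abelian_top_groupD: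
  assumes "abelian_top_group G T"
  shows "comm_group G" "group_topology G T" "topspace T = carrier G"
  using assms by (auto simp: abelian_top_group_def group_topology_def)

lemma reflexive_bidual_characters:
  assumes "reflexive_group G T"
  shows "characters (dual_group G T) (dual_topology G T) = canonical_hom G T ` carrier G"
  using assms
  by (auto simp: reflexive_group_def iso_def bidual_group_def bij_betw_def)

lemma reflexive_imp_MAP:
  assumes "reflexive_group G T"
  shows "MAP_group G T"
  unfolding MAP_group_def
proof (intro ballI impI)
  fix x y assume "x \<in> carrier G" "y \<in> carrier G" "x \<noteq> y"
  moreover have "inj_on (canonical_hom G T) (carrier G)"
    using assms by (auto simp: reflexive_group_def iso_def bij_betw_def)
  ultimately have "canonical_hom G T x \<noteq> canonical_hom G T y"
    by (auto dest: inj_onD)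
  then show "\<exists>\<phi>\<in>characters G T. \<phi> x \<noteq> \<phi> y"
    by (auto simp: canonical_hom_def fun_eq_iff split: if_splits)
qed

text \<open>The open right half of the circle gives a subbasic open set of the bidual inside the prepolar
  of \<open>K\<close>, and the continuous canonical map pulls it back to \<open>G\<close>.\<close>

lemma reflexive_prepolar_neighbourhood:
  fixes G (structure)
  assumes G: "abelian_top_group G T" and R: "reflexive_group G T"
    and K: "compactin (dual_topology G T) K"
  shows "\<exists>A. openin T A \<and> \<one>\<^bsub>G\<^esub> \<in> A \<and> A \<subseteq> prepolar G K"
proof -
  interpret comm_group G
    using G by (simp add: abelian_top_group_def)
  note top = abelian_top_groupD[OF G]
  let ?V = "{z \<in> sphere 0 1. 0 < Re z}"
  let ?W = "{\<Phi> \<in> characters (dual_group G T) (dual_topology G T). \<Phi> ` K \<subseteq> ?V}"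
  define A where "A = {g \<in> carrier G. canonical_hom G T g \<in> ?W}"
  have "?V = sphere 0 1 \<inter> {z. 0 < Re z}"
    by auto
  then have "openin circle_topology ?V"
    by (simp add: circle_topology_def openin_open_Int open_halfspace_Re_gt)
  then have "openin (bidual_topology G T) ?W"
    unfolding bidual_topology_def by (rule openin_dual_topology_subbasic[OF K])
  moreover have "continuous_map T (bidual_topology G T) (canonical_hom G T)"
    using R by (simp add: reflexive_group_def homeomorphic_imp_continuous_map)
  ultimately have "openin T A"
    using openin_continuous_map_preimage[of T _ "canonical_hom G T" ?W] top(3) by (simp add: A_def)
  have K_sub: "K \<subseteq> characters G T"
    using compactin_subset_topspace[OF K] by (simp add: topspace_dual_topology)
  have val: "canonical_hom G T \<one> ` K = (\<lambda>\<phi>. \<phi> \<one>) ` K"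
    using K_sub by (intro image_cong) (auto simp: canonical_hom_def)
  have "(\<lambda>\<phi>. \<phi> \<one>) ` K \<subseteq> {1}"
    using K_sub hom_circle_one[OF top(1) character_hom] by blast
  then have "canonical_hom G T \<one> ` K \<subseteq> ?V"
    unfolding val by (rule order_trans) auto
  then have "\<one> \<in> A"
    using reflexive_bidual_characters[OF R] by (auto simp: A_def)
  moreover have "A \<subseteq> prepolar G K"
    using K_sub by (auto simp: A_def prepolar_def circle_plus_def image_subset_iff canonical_hom_def)
  ultimately show ?thesis
    using \<open>openin T A\<close> by blast
qed

text \<open>The canonical map is open, so this is the base of polars in the dual of the dual group, read
  on \<open>G\<close>: under the canonical map the polar of \<open>K\<close> is the prepolar of \<open>K\<close>.\<close>

lemma reflexive_prepolar_base:
  fixes G (structure)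
  assumes G: "abelian_top_group G T" and R: "reflexive_group G T"
    and W: "openin T W" "\<one>\<^bsub>G\<^esub> \<in> W"
  shows "\<exists>K. compactin (dual_topology G T) K \<and> prepolar G K \<subseteq> W"
proof -
  interpret comm_group G
    using G by (simp add: abelian_top_group_def)
  note top = abelian_top_groupD[OF G]
  let ?\<alpha> = "canonical_hom G T" and ?H = "dual_group G T" and ?D = "dual_topology G T"
  have H: "comm_group ?H"
    by (rule comm_group_dual_group[OF top(1,3)])
  have "openin (bidual_topology G T) (?\<alpha> ` W)"
    using R W(1) homeomorphic_map_openness[OF _ openin_subset[OF W(1)]]
    by (auto simp: reflexive_group_def)
  then have open_image: "openin (dual_topology ?H ?D) (?\<alpha> ` W)"
    by (simp add: bidual_topology_def)
  have "\<phi> \<one> = 1" if "\<phi> \<in> characters G T" for \<phi>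
    using that hom_circle_one[OF top(1) character_hom] by blast
  then have "?\<alpha> \<one> = \<one>\<^bsub>dual_group ?H ?D\<^esub>"
    by (auto simp: canonical_hom_def dual_group_def fun_eq_iff)
  then have "\<one>\<^bsub>dual_group ?H ?D\<^esub> \<in> ?\<alpha> ` W"
    using W(2) by (metis imageI)
  then obtain K where K: "compactin ?D K" "polar ?H ?D K \<subseteq> ?\<alpha> ` W"
    using polar_base_dual_topology[OF H topspace_dual_topology
        continuous_map_dual_square[OF top(1,3)] open_image] by blast
  have K_sub: "K \<subseteq> characters G T"
    using compactin_subset_topspace[OF K(1)] by (simp add: topspace_dual_topology)
  have "prepolar G K \<subseteq> W"
  proof
    fix g assume g: "g \<in> prepolar G K"
    then have gG: "g \<in> carrier G"
      by (simp add: prepolar_def)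
    have "?\<alpha> g ` K \<subseteq> circle_plus"
      using g K_sub by (auto simp: prepolar_def canonical_hom_def)
    then have "?\<alpha> g \<in> polar ?H ?D K"
      using gG reflexive_bidual_characters[OF R] by (auto simp: polar_def)
    then obtain h where h: "h \<in> W" "?\<alpha> g = ?\<alpha> h"
      using K(2) by blast
    moreover have "h \<in> carrier G"
      using h(1) openin_subset[OF W(1)] top(3) by auto
    moreover have "inj_on ?\<alpha> (carrier G)"
      using R by (auto simp: reflexive_group_def iso_def bij_betw_def)
    ultimately show "g \<in> W"
      using gG by (metis inj_onD)
  qed
  then show ?thesis
    using K(1) by blast
qed

lemma reflexive_imp_locally_quasi_convex:
  assumes G: "abelian_top_group G T" and R: "reflexive_group G T"
  shows "locally_quasi_convex G T"
  unfolding locally_quasi_convex_def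
proof (intro conjI)
  show "neighbourhood_base_at \<one>\<^bsub>G\<^esub> (quasi_convex G T) T"
    unfolding neighbourhood_base_at_def
  proof (intro allI impI)
    fix W assume "openin T W \<and> \<one>\<^bsub>G\<^esub> \<in> W"
    then obtain K where K: "compactin (dual_topology G T) K" "prepolar G K \<subseteq> W"
      using reflexive_prepolar_base[OF G R] by blast
    have "quasi_convex G T (prepolar G K)"
      using compactin_subset_topspace[OF K(1)]
      by (intro quasi_convex_prepolar) (simp add: topspace_dual_topology)
    then show "\<exists>U V. openin T U \<and> quasi_convex G T V \<and> \<one>\<^bsub>G\<^esub> \<in> U \<and> U \<subseteq> V \<and> V \<subseteq> W"
      using reflexive_prepolar_neighbourhood[OF G R K(1)] K(2) by blast
  qed
qed (use G reflexive_imp_MAP[OF R] in auto)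

section \<open>The weak topology of the dual of a reflexive group\<close>

text \<open>Since the characters of the dual are the evaluations, its weak topology is the topology of
  pointwise convergence.\<close>

lemma reflexive_compactin_weak_dual:
  assumes G: "abelian_top_group G T" and R: "reflexive_group G T"
    and K: "K \<subseteq> characters G T"
      "compactin (product_topology (\<lambda>_. circle_topology) (carrier G)) K"
  shows "compactin (weak_topology (dual_group G T) (dual_topology G T)) K"
proof -
  note top = abelian_top_groupD[OF G]
  let ?H = "dual_group G T" and ?D = "dual_topology G T"
  let ?P = "subtopology (product_topology (\<lambda>_. circle_topology) (carrier G)) (characters G T)"
  have H: "comm_group ?H"
    by (rule comm_group_dual_group[OF top(1,3)])
  note weak = weak_topology_eq[OF H topspace_dual_topology]
  have "characters G T \<subseteq> topspace (product_topology (\<lambda>_. circle_topology) (carrier G))"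
  proof
    fix \<phi> assume \<phi>: "\<phi> \<in> characters G T"
    then show "\<phi> \<in> topspace (product_topology (\<lambda>_. circle_topology) (carrier G))"
      using character_norm[OF \<phi>] by (simp add: characters_def PiE_def Pi_def)
  qed
  then have topP: "topspace ?P = characters G T"
    by auto
  have top_weak: "topspace (char_topology ?H ?D) = characters G T"
    using is_weak_topology_char_topology[OF H topspace_dual_topology]
    by (simp add: is_weak_topology_def group_topology_def)
  have "continuous_map ?P (char_topology ?H ?D) id"
  proof (subst char_topology_def, rule continuous_on_generated_topo)
    fix W assume "W \<in> {{x \<in> carrier ?H. \<Phi> x \<in> V} |\<Phi> V.
        \<Phi> \<in> characters ?H ?D \<and> openin circle_topology V}"
    then obtain g V where g: "g \<in> carrier G" and V: "openin circle_topology V"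
        and W: "W = {\<phi> \<in> characters G T. canonical_hom G T g \<phi> \<in> V}"
      using reflexive_bidual_characters[OF R] by auto
    have "continuous_map ?P circle_topology (\<lambda>\<phi>. \<phi> g)"
      using continuous_map_product_projection[OF g, of "\<lambda>_. circle_topology"]
      by (intro continuous_map_from_subtopology) fast
    from openin_continuous_map_preimage[OF this V]
    have "openin ?P {\<phi> \<in> characters G T. \<phi> g \<in> V}"
      by (simp only: topP)
    moreover have "id -` W \<inter> topspace ?P = {\<phi> \<in> characters G T. \<phi> g \<in> V}"
      unfolding topP by (auto simp: W canonical_hom_def)
    ultimately show "openin ?P (id -` W \<inter> topspace ?P)"
      by simp
  next
    show "id ` topspace ?P \<subseteq> \<Union> {{x \<in> carrier ?H. \<Phi> x \<in> V} |\<Phi> V.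
        \<Phi> \<in> characters ?H ?D \<and> openin circle_topology V}"
      using top_weak topP unfolding char_topology_def topology_generated_by_topspace by auto
  qed
  moreover have "compactin ?P K"
    using K by (simp add: compactin_subtopology)
  ultimately have "compactin (char_topology ?H ?D) (id ` K)"
    by (rule image_compactin[rotated])
  then show ?thesis
    by (simp add: weak)
qed

text \<open>A character outside the polar of \<open>U\<close> is separated from it by the evaluation at some point of \<open>U\<close>,
  which is weakly continuous.\<close>

lemma quasi_convex_polar:
  assumes G: "abelian_top_group G T" and R: "reflexive_group G T" and U: "U \<subseteq> carrier G"
  shows "quasi_convex (dual_group G T) (weak_topology (dual_group G T) (dual_topology G T))
           (polar G T U)"
  unfolding quasi_convex_def
proof (intro conjI ballI)
  let ?H = "dual_group G T" and ?D = "dual_topology G T"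
  show "polar G T U \<subseteq> carrier ?H"
    by (auto simp: polar_def)
  fix \<phi> assume "\<phi> \<in> carrier ?H - polar G T U"
  then obtain g where \<phi>: "\<phi> \<in> characters G T" and g: "g \<in> U" "\<phi> g \<notin> circle_plus"
    by (auto simp: polar_def)
  let ?\<Phi> = "canonical_hom G T g"
  have "?\<Phi> \<in> characters ?H ?D"
    using reflexive_bidual_characters[OF R] g(1) U by blast
  then have "?\<Phi> \<in> characters ?H (weak_topology ?H ?D)"
    using is_weak_topology_dual[OF G] by (simp add: is_weak_topology_def characters_def[of ?H])
  moreover have "?\<Phi> \<phi> \<notin> circle_plus" "?\<Phi> ` polar G T U \<subseteq> circle_plus"
    using \<phi> g by (auto simp: canonical_hom_def polar_def)
  ultimately show "\<exists>\<Phi>\<in>characters ?H (weak_topology ?H ?D).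
      \<Phi> \<phi> \<notin> circle_plus \<and> \<Phi> ` polar G T U \<subseteq> circle_plus"
    by blast
qed

section \<open>Mackey groups\<close>

text \<open>Both Glicksberg properties act through the hypothesis on weakly compact quasi-convex sets.\<close>

lemma reflexive_imp_Mackey:
  assumes G: "abelian_top_group G T" and R: "reflexive_group G T"
    and compact: "\<And>K. quasi_convex (dual_group G T)
          (weak_topology (dual_group G T) (dual_topology G T)) K \<Longrightarrow>
        compactin (weak_topology (dual_group G T) (dual_topology G T)) K \<Longrightarrow>
        compactin (dual_topology G T) K"
  shows "Mackey_group G T"
  unfolding Mackey_group_def
proof (intro conjI allI impI)
  show "locally_quasi_convex G T"
    by (rule reflexive_imp_locally_quasi_convex[OF G R])
next
  fix S assume S: "locally_quasi_convex G S \<and> compatible_topologies G S T"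
  then have same: "polar G S = polar G T"
    by (auto simp: compatible_topologies_def polar_def fun_eq_iff)
  have S': "abelian_top_group G S" and base: "neighbourhood_base_at \<one>\<^bsub>G\<^esub> (quasi_convex G S) S"
    using S by (auto simp: locally_quasi_convex_def)
  note top = abelian_top_groupD[OF G] and topS = abelian_top_groupD[OF S']
  show "coarser S T"
  proof (rule coarser_if_neighbourhoods_of_one[OF top(1) topS(2) top(2)])
    fix W assume "openin S W" "\<one>\<^bsub>G\<^esub> \<in> W"
    then obtain N U where N: "openin S N" "\<one>\<^bsub>G\<^esub> \<in> N" "N \<subseteq> U"
        and U: "quasi_convex G S U" "U \<subseteq> W"
      using base unfolding neighbourhood_base_at_def by meson
    have sub: "U \<subseteq> carrier G"
      using U(1) by (simp add: quasi_convex_def)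
    have "compactin (product_topology (\<lambda>_. circle_topology) (carrier G)) (polar G T U)"
      using compactin_polar[OF top(1) topS(2) N sub] by (simp add: same)
    then have "compactin (weak_topology (dual_group G T) (dual_topology G T)) (polar G T U)"
      by (intro reflexive_compactin_weak_dual[OF G R]) (auto simp: polar_def)
    then have "compactin (dual_topology G T) (polar G T U)"
      by (intro compact quasi_convex_polar[OF G R sub])
    then obtain A where "openin T A" "\<one>\<^bsub>G\<^esub> \<in> A" "A \<subseteq> prepolar G (polar G T U)"
      using reflexive_prepolar_neighbourhood[OF G R] by blast
    moreover have "prepolar G (polar G T U) = U"
      using prepolar_polar[OF U(1)] by (simp add: same)
    ultimately show "\<exists>A. openin T A \<and> \<one>\<^bsub>G\<^esub> \<in> A \<and> A \<subseteq> W"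
      using U(2) by blast
  qed
qed

theorem theorem2p4:
  fixes G :: "('a, 'm) monoid_scheme" and T :: "'a topology"
  assumes "abelian_top_group G T"
    and "reflexive_group G T"
  shows "(qc_Glicksberg_property (dual_group G T) (dual_topology G T) \<longrightarrow> Mackey_group G T) \<and>
         (Glicksberg_property (dual_group G T) (dual_topology G T) \<longrightarrow> Mackey_group G T)"
proof (intro conjI impI)
  assume "qc_Glicksberg_property (dual_group G T) (dual_topology G T)"
  then show "Mackey_group G T"
    unfolding qc_Glicksberg_property_def
    by (intro reflexive_imp_Mackey[OF assms]) blast
next
  assume "Glicksberg_property (dual_group G T) (dual_topology G T)"
  then show "Mackey_group G T"
    unfolding Glicksberg_property_def
    by (intro reflexive_imp_Mackey[OF assms]) blast
qed

end
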